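(* Let $D_{11}>0$, $v_0\in\mathbb{R}$, $L>0$ and $x\in(0,L]$. Put $\alpha=\frac{v_0}{2D_{11}}$, $s_0=-\frac{v_0^2}{4D_{11}^2}$, and for $s>0$ put $\beta=\beta(s)=\sqrt{\frac{s}{D_{11}}-s_0}$ and $$G(x,s)=-e^{\alpha x}\,\frac{\sinh((L-x)\beta)}{\sinh(L\beta)}.$$ Then the inverse Laplace transform $g(x,\cdot)$ of $G(x,\cdot)$ is given, for every $t>0$, by both of the following (equal) convergent series: $$g(x,t)=-e^{\alpha x}\sum_{m=1}^{\infty}\frac{2m\pi D_{11}}{L^2}\,e^{s_mt}\sin\Big(\frac{m\pi x}{L}\Big),\qquad s_m=-\frac{v_0^2}{4D_{11}}-\frac{m^2\pi^2D_{11}}{L^2},$$ and $$g(x,t)=-\frac{e^{\alpha x+D_{11}s_0t}}{2\sqrt{\pi D_{11}t^3}}\sum_{n\in\mathbb{Z}}(x+2nL)\,e^{-\frac{(x+2nL)^2}{4D_{11}t}}.$$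
   Context: That $g(x,\cdot)$ is the inverse Laplace transform of $G(x,\cdot)$ means $\int_0^\infty e^{-st}g(x,t)\,dt=G(x,s)$ for all $s>0$. *)

theory Defs
  imports "HOL-Analysis.Analysis"
begin

text \<open>
  The integral over \<open>(0, \<infinity>)\<close> is a Lebesgue integral. Integrability has to be required explicitly,
  because the integral of a non-integrable function is 0 by convention.
\<close>

definition is_inverse_laplace :: "(real \<Rightarrow> real) \<Rightarrow> (real \<Rightarrow> real) \<Rightarrow> bool" where
  "is_inverse_laplace g G \<longleftrightarrow>
     (\<forall>s>0. set_integrable lborel {0<..} (\<lambda>t. exp (- s * t) * g t) \<and>
            (LBINT t:{0<..}. exp (- s * t) * g t) = G s)"

definition alpha :: "real \<Rightarrow> real \<Rightarrow> real" where
  "alpha D11 v0 = v0 / (2 * D11)"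

definition s_zero :: "real \<Rightarrow> real \<Rightarrow> real" where
  "s_zero D11 v0 = - (v0\<^sup>2 / (4 * D11\<^sup>2))"

definition beta :: "real \<Rightarrow> real \<Rightarrow> real \<Rightarrow> real" where
  "beta D11 v0 s = sqrt (s / D11 - s_zero D11 v0)"

definition G :: "real \<Rightarrow> real \<Rightarrow> real \<Rightarrow> real \<Rightarrow> real \<Rightarrow> real" where
  "G D11 v0 L x s =
     - exp (alpha D11 v0 * x) * (sinh ((L - x) * beta D11 v0 s) / sinh (L * beta D11 v0 s))"

text \<open>
  Only the values for \<open>m \<ge> 1\<close> are used; the value at \<open>m = 0\<close> is \<open>D11 * s_zero D11 v0\<close>,
  not \<open>s_zero D11 v0\<close>.
\<close>

definition s_pole :: "real \<Rightarrow> real \<Rightarrow> real \<Rightarrow> nat \<Rightarrow> real" where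
  "s_pole D11 v0 L m = - (v0\<^sup>2 / (4 * D11)) - (real m)\<^sup>2 * pi\<^sup>2 * D11 / L\<^sup>2"

definition pole_term :: "real \<Rightarrow> real \<Rightarrow> real \<Rightarrow> real \<Rightarrow> real \<Rightarrow> nat \<Rightarrow> real" where
  "pole_term D11 v0 L x t m =
     2 * real m * pi * D11 / L\<^sup>2 * exp (s_pole D11 v0 L m * t) * sin (real m * pi * x / L)"

definition image_term :: "real \<Rightarrow> real \<Rightarrow> real \<Rightarrow> real \<Rightarrow> int \<Rightarrow> real" where
  "image_term D11 L x t n =
     (x + 2 * of_int n * L) * exp (- ((x + 2 * of_int n * L)\<^sup>2 / (4 * D11 * t)))"

end

theory Submission
  imports Defs "HOL-Probability.Probability" "HOL-Real_Asymp.Real_Asymp"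
begin

text \<open>
  Expanding \<open>sinh ((L - x) \<beta>) / sinh (L \<beta>)\<close> as a geometric series in \<open>exp (- 2 L \<beta>)\<close> and inverting
  each \<open>exp (- y \<beta>)\<close> (an inverse Gaussian density) termwise gives the image series. It is an odd
  \<open>2 L\<close>-periodic function of \<open>x\<close> whose sine coefficients unfold to one Gaussian integral over the half
  line; these are the coefficients of the pole series, and a continuous function on \<open>[0, L]\<close> is
  determined by its sine coefficients. Both this uniqueness and that of the inverse Laplace
  transform reduce, via \<open>u = cos (\<pi> x / L)\<close> and \<open>u = exp (- t)\<close>, to Weierstrass approximation on a
  compact interval.
\<close>

section \<open>Uniqueness of moments, Laplace transforms and sine coefficients\<close>

text \<open>The obstacle is that the pole series resists a termwise Laplace transform: its
  \<open>m\<close>-th term has a transform of order \<open>1 / m\<close>, so for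
  \<open>0 < x < L\<close> the transformed series converges only conditionally, and absolute
  convergence cannot justify exchanging sum and integral. The images behave better, because the
  transforms of their absolute values are bounded by geometric sequences. Hence only the image
  series is ever Laplace transformed, which also avoids contour integration. The pole series is
  compared with it at each fixed \<open>t\<close>. There the factors depending on \<open>t\<close>
  alone split off, and both sides become functions of \<open>x\<close> with the single parameter
  \<open>c = 4 * D11 * t\<close>; Gaussian decay then makes both series converge absolutely and
  uniformly on \<open>{0..L}\<close>.\<close>

text \<open>A polynomial \<open>p\<close> uniformly \<open>e\<close>-close to \<phi> on the range of
  \<open>u\<close> is annihilated by the moments, and the error costs at most \<open>e\<close> times
  the integral of \<open>\<bar>w x\<bar>\<close>. Leaving \<open>u\<close> general lets one argument
  serve both \<open>exp (- t)\<close> and the cosine.\<close>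

lemma integral_continuous_eq_0_if_moments_eq_0:
  fixes u w :: "'a \<Rightarrow> real" and \<phi> :: "real \<Rightarrow> real"
  assumes w: "integrable M w"
    and u [measurable]: "u \<in> borel_measurable M" and range: "\<And>x. u x \<in> {a..b}"
    and moments: "\<And>k. (\<integral>x. u x ^ k * w x \<partial>M) = 0"
    and \<phi>: "continuous_on {a..b} \<phi>"
  shows "(\<integral>x. \<phi> (u x) * w x \<partial>M) = 0"
proof -
  have int: "integrable M (\<lambda>x. \<psi> (u x) * w x)" if \<psi>: "continuous_on {a..b} \<psi>" for \<psi> :: "real \<Rightarrow> real"
  proof -
    have ab: "a \<le> b"
      using range[of undefined] by simp
    obtain B where B: "\<And>y. y \<in> {a..b} \<Longrightarrow> \<bar>\<psi> y\<bar> \<le> B"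
      using compact_imp_bounded[OF compact_continuous_image[OF \<psi> compact_Icc]] by (force simp: bounded_iff)
    \<comment> \<open>\<psi> is controlled only on \<open>{a..b}\<close>. Clamping the argument
      gives a function continuous everywhere that agrees with \<psi> on the range of
      \<open>u\<close>, hence measurability of the composition.\<close>
    have "continuous_on UNIV (\<lambda>y. \<psi> (max a (min b y)))"
      by (rule continuous_on_compose2[OF \<psi>]) (use ab in \<open>auto intro!: continuous_intros\<close>)
    then have "(\<lambda>x. \<psi> (max a (min b (u x)))) \<in> borel_measurable M"
      by (rule borel_measurable_continuous_on) (rule u)
    moreover have "max a (min b (u x)) = u x" for x
      using range[of x] by auto
    ultimately have [measurable]: "(\<lambda>x. \<psi> (u x)) \<in> borel_measurable M"
      by simp
    show ?thesis
    proof (rule Bochner_Integration.integrable_bound)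
      show "integrable M (\<lambda>x. B * w x)"
        using w by simp
      show "(\<lambda>x. \<psi> (u x) * w x) \<in> borel_measurable M"
        using w by measurable
      show "AE x in M. norm (\<psi> (u x) * w x) \<le> norm (B * w x)"
      proof (rule AE_I2)
        fix x
        have "\<bar>\<psi> (u x)\<bar> \<le> \<bar>B\<bar>"
          using B[OF range[of x]] by linarith
        then show "norm (\<psi> (u x) * w x) \<le> norm (B * w x)"
          by (simp add: abs_mult mult_right_mono)
      qed
    qed
  qed
  have bound: "\<bar>\<integral>x. \<phi> (u x) * w x \<partial>M\<bar> \<le> e * (\<integral>x. \<bar>w x\<bar> \<partial>M)" if "e > 0" for e
  proof -
    obtain p where p: "real_polynomial_function p" "\<And>y. y \<in> {a..b} \<Longrightarrow> \<bar>\<phi> y - p y\<bar> < e"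
      using Stone_Weierstrass_real_polynomial_function[OF compact_Icc \<phi> \<open>e > 0\<close>] by blast
    then obtain c n where c: "p = (\<lambda>y. \<Sum>i\<le>n. c i * y ^ i)"
      by (auto simp: real_polynomial_function_iff_sum)
    have "(\<integral>x. p (u x) * w x \<partial>M) = (\<integral>x. (\<Sum>i\<le>n. c i * (u x ^ i * w x)) \<partial>M)"
      by (simp add: c sum_distrib_right mult.assoc)
    also have "\<dots> = (\<Sum>i\<le>n. \<integral>x. c i * (u x ^ i * w x) \<partial>M)"
      by (rule Bochner_Integration.integral_sum)
        (intro integrable_mult_right int continuous_intros)
    also have "\<dots> = 0"
      by (simp add: moments)
    finally have p0: "(\<integral>x. p (u x) * w x \<partial>M) = 0" .
    have pc: "continuous_on {a..b} p"
      by (simp add: c continuous_intros)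
    have "(\<integral>x. (\<phi> (u x) - p (u x)) * w x \<partial>M) = (\<integral>x. \<phi> (u x) * w x - p (u x) * w x \<partial>M)"
      by (simp add: algebra_simps)
    also have "\<dots> = (\<integral>x. \<phi> (u x) * w x \<partial>M)"
      using int[OF \<phi>] int[OF pc] p0 by (subst Bochner_Integration.integral_diff) auto
    finally have eq: "(\<integral>x. \<phi> (u x) * w x \<partial>M) = (\<integral>x. (\<phi> (u x) - p (u x)) * w x \<partial>M)" ..
    have "\<bar>\<integral>x. (\<phi> (u x) - p (u x)) * w x \<partial>M\<bar> \<le> (\<integral>x. \<bar>(\<phi> (u x) - p (u x)) * w x\<bar> \<partial>M)"
      using integral_norm_bound[of M "\<lambda>x. (\<phi> (u x) - p (u x)) * w x"] by simp
    also have "\<dots> \<le> (\<integral>x. e * \<bar>w x\<bar> \<partial>M)"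
    proof (rule integral_mono)
      show "integrable M (\<lambda>x. \<bar>(\<phi> (u x) - p (u x)) * w x\<bar>)"
        by (intro integrable_abs int[of "\<lambda>y. \<phi> y - p y"] continuous_intros \<phi> pc)
      show "integrable M (\<lambda>x. e * \<bar>w x\<bar>)"
        using w by simp
      show "\<bar>(\<phi> (u x) - p (u x)) * w x\<bar> \<le> e * \<bar>w x\<bar>" for x
        using p(2)[OF range[of x]] by (simp add: abs_mult mult_right_mono)
    qed
    finally show ?thesis
      by (simp add: eq)
  qed
  define W where "W = (\<integral>x. \<bar>w x\<bar> \<partial>M)"
  have W: "W \<ge> 0"
    by (simp add: W_def)
  have "\<bar>\<integral>x. \<phi> (u x) * w x \<partial>M\<bar> \<le> 0"
  proof (rule field_le_epsilon)
    fix e :: real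
    assume "e > 0"
    \<comment> \<open>\<open>W + 1\<close> instead of \<open>W\<close> in the denominator covers the
      case \<open>W = 0\<close>.\<close>
    then have "\<bar>\<integral>x. \<phi> (u x) * w x \<partial>M\<bar> \<le> e / (W + 1) * W"
      using W bound[of "e / (W + 1)"] by (simp add: W_def[symmetric])
    also have "\<dots> \<le> e"
      using \<open>e > 0\<close> W by (simp add: field_simps)
    finally show "\<bar>\<integral>x. \<phi> (u x) * w x \<partial>M\<bar> \<le> 0 + e"
      by simp
  qed
  then show ?thesis
    by simp
qed

text \<open>Open rays form an intersection-stable generator of the Borel sets, so a Dynkin argument
  carries vanishing integrals from rays to all Borel sets. The assumption \<open>total\<close> is
  what the complement step consumes.\<close>

lemma AE_eq_0_if_set_integral_greaterThan_eq_0: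
  fixes w :: "real \<Rightarrow> real"
  assumes w: "integrable lborel w"
    and total: "(\<integral>t. w t \<partial>lborel) = 0"
    and ray: "\<And>a. (LBINT t:{a<..}. w t) = 0"
  shows "AE t in lborel. w t = 0"
proof (rule sigma_finite_measure.density_zero[OF sigma_finite_lborel w])
  have borel: "sets borel = sigma_sets UNIV (range (greaterThan :: real \<Rightarrow> real set))"
    by (simp add: borel_Ioi)
  fix A :: "real set"
  assume "A \<in> sets lborel"
  then have A: "A \<in> sigma_sets UNIV (range greaterThan)"
    by (simp add: borel)
  have int: "set_integrable lborel B w" if "B \<in> sigma_sets UNIV (range greaterThan)" for B
    unfolding set_integrable_def
    by (rule integrable_mult_indicator[OF _ w]) (use that in \<open>simp add: borel\<close>)
  have "{a<..} \<inter> {b<..} = {max a b<..}" for a b :: real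
    by auto
  then have stable: "Int_stable (range (greaterThan :: real \<Rightarrow> real set))"
    by (auto simp: Int_stable_def)
  have "range greaterThan \<subseteq> Pow (UNIV :: real set)"
    by simp
  from stable this A show "set_lebesgue_integral lborel A w = 0"
  proof (induction rule: sigma_sets_induct_disjoint)
    case (compl B)
    have "(LBINT t:B \<union> (UNIV - B). w t) = (LBINT t:B. w t) + (LBINT t:UNIV - B. w t)"
      by (intro set_integral_Un int compl) (auto intro: compl sigma_sets.Compl)
    with compl total show ?case
      by (simp add: set_lebesgue_integral_def)
  next
    case (union B)
    have "set_integrable lborel (\<Union> (range B)) w"
      by (intro int sigma_sets.Union) (use union in auto)
    then have "(LBINT t:\<Union> (range B). w t) = (\<Sum>i. LBINT t:B i. w t)"
      using union by (intro lebesgue_integral_countable_add)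
        (auto simp: disjoint_family_on_def borel)
    with union show ?case
      by simp
  qed (use ray in \<open>auto simp: set_lebesgue_integral_def\<close>)
qed

text \<open>The arguments \<open>s = k + 1\<close> suffice: there the two transforms differ by the
  \<open>k\<close>-th moment of \<open>exp (- t)\<close> against the difference \<open>w\<close>.
  The weight \<open>exp (- t)\<close> inside \<open>w\<close> provides integrability, which is given
  only for \<open>s > 0\<close>.\<close>

lemma is_inverse_laplace_unique:
  assumes g: "is_inverse_laplace g F" and h: "is_inverse_laplace h F"
  shows "AE t in lborel. t > 0 \<longrightarrow> h t = g t"
proof -
  let ?I = "indicator {0<..} :: real \<Rightarrow> real"
  define w where "w t = ?I t * (exp (- t) * h t) - ?I t * (exp (- t) * g t)" for t
  have gi: "integrable lborel (\<lambda>t. ?I t * (exp (- s * t) * g t))"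
      "(\<integral>t. ?I t * (exp (- s * t) * g t) \<partial>lborel) = F s" if "s > 0" for s
    using g that by (auto simp: is_inverse_laplace_def set_integrable_def set_lebesgue_integral_def)
  have hi: "integrable lborel (\<lambda>t. ?I t * (exp (- s * t) * h t))"
      "(\<integral>t. ?I t * (exp (- s * t) * h t) \<partial>lborel) = F s" if "s > 0" for s
    using h that by (auto simp: is_inverse_laplace_def set_integrable_def set_lebesgue_integral_def)
  have w: "integrable lborel w"
    unfolding w_def using gi(1)[of 1] hi(1)[of 1] by simp
  \<comment> \<open>Cutting off at 0 keeps \<open>u\<close> in \<open>{0..1}\<close> on the whole
    line; for \<open>t \<le> 0\<close> nothing changes because \<open>w\<close> vanishes
    there.\<close>
  define u where "u t = exp (- max 0 t)" for t :: real
  have u [measurable]: "u \<in> borel_measurable lborel"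
    unfolding u_def by measurable
  have range: "u t \<in> {0..1}" for t
    by (simp add: u_def)
  have moments: "(\<integral>t. u t ^ k * w t \<partial>lborel) = 0" for k
  proof -
    have "u t ^ k * w t = ?I t * (exp (- real (Suc k) * t) * h t)
        - ?I t * (exp (- real (Suc k) * t) * g t)" for t
    proof (cases "t > 0")
      case True
      then have "u t ^ k * exp (- t) = exp (- real (Suc k) * t)"
        by (simp add: u_def max_def exp_of_nat_mult[symmetric] exp_add[symmetric] algebra_simps)
      with True show ?thesis
        by (simp add: w_def algebra_simps del: of_nat_Suc)
    qed (simp add: w_def)
    then show ?thesis
      using gi[of "real (Suc k)"] hi[of "real (Suc k)"] by simp
  qed
  have "AE t in lborel. w t = 0"
  proof (rule AE_eq_0_if_set_integral_greaterThan_eq_0[OF w])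
    show total: "(\<integral>t. w t \<partial>lborel) = 0"
      using moments[of 0] by simp
    show "(LBINT t:{a<..}. w t) = 0" for a
    proof (cases "a > 0")
      case False
      then have "indicator {a<..} t *\<^sub>R w t = w t" for t
        by (auto simp: w_def indicator_def)
      then show ?thesis
        unfolding set_lebesgue_integral_def by (simp only: total)
    next
      case True
      \<comment> \<open>Continuous ramps that increase to the indicator of
        \<open>y < exp (- a)\<close>, which under \<open>u\<close> is the ray \<open>t > a\<close>.
        They vanish at \<open>y = exp (- a)\<close> itself, so the limit is the open ray.\<close>
      define \<phi> where "\<phi> k y = max 0 (min 1 (real k * (exp (- a) - y)))" for k y
      have "(\<lambda>k. \<integral>t. \<phi> k (u t) * w t \<partial>lborel) \<longlonglongrightarrow> (\<integral>t. indicator {a<..} t *\<^sub>R w t \<partial>lborel)"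
      proof (rule integral_dominated_convergence[where w = "\<lambda>t. \<bar>w t\<bar>"])
        show "(\<lambda>t. indicator {a<..} t *\<^sub>R w t) \<in> borel_measurable lborel"
          using w by measurable
        show "(\<lambda>t. \<phi> k (u t) * w t) \<in> borel_measurable lborel" for k
          unfolding \<phi>_def using w by measurable
        show "integrable lborel (\<lambda>t. \<bar>w t\<bar>)"
          using w by simp
        show "AE t in lborel. norm (\<phi> k (u t) * w t) \<le> \<bar>w t\<bar>" for k
          by (intro AE_I2) (auto simp: \<phi>_def abs_mult intro!: mult_left_le_one_le)
        show "AE t in lborel. (\<lambda>k. \<phi> k (u t) * w t) \<longlonglongrightarrow> indicator {a<..} t *\<^sub>R w t"
        proof (rule AE_I2)
          fix t
          have "(\<lambda>k. \<phi> k (u t)) \<longlonglongrightarrow> indicator {a<..} t"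
          proof (cases "t > a")
            case True
            then have d: "exp (- a) - u t > 0"
              using \<open>a > 0\<close> by (simp add: u_def)
            have "\<forall>\<^sub>F k in sequentially. real k \<ge> 1 / (exp (- a) - u t)"
              by real_asymp
            then have "\<forall>\<^sub>F k in sequentially. \<phi> k (u t) = 1"
              by eventually_elim (use d in \<open>simp add: \<phi>_def field_simps\<close>)
            with True show ?thesis
              by (simp add: tendsto_eventually)
          next
            case False
            then have "exp (- a) - u t \<le> 0"
              using \<open>a > 0\<close> by (simp add: u_def)
            then have "real k * (exp (- a) - u t) \<le> 0" for k
              by (simp add: mult_nonneg_nonpos)
            then have "\<phi> k (u t) = 0" for k
              unfolding \<phi>_def by (metis max.absorb1 min.coboundedI2)
            with False show ?thesis
              by simp
          qed
          then show "(\<lambda>k. \<phi> k (u t) * w t) \<longlonglongrightarrow> indicator {a<..} t *\<^sub>R w t"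
            by (simp add: tendsto_mult_right)
        qed
      qed
      moreover have "(\<integral>t. \<phi> k (u t) * w t \<partial>lborel) = 0" for k
        by (rule integral_continuous_eq_0_if_moments_eq_0[OF w u range moments])
          (auto simp: \<phi>_def intro!: continuous_intros)
      ultimately show ?thesis
        by (simp add: set_lebesgue_integral_def LIMSEQ_const_iff)
    qed
  qed
  then show ?thesis
    by eventually_elim (auto simp: w_def)
qed

text \<open>On \<open>{0..L}\<close> the map \<open>cos (c y)\<close> is invertible, so
  \<open>f\<close> is a continuous function \<phi> of it and may be tested against itself: the
  integral of \<open>(f y)\<^sup>2 * sin (c y)\<close> vanishes. The integrand is nonnegative and
  the weight positive inside, so \<open>f\<close> is 0 on the open interval. The weight vanishes at
  the endpoints, where continuity of \<open>f\<close> finishes the argument.\<close>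

lemma continuous_eq_0_if_sine_coefficients_eq_0:
  fixes f :: "real \<Rightarrow> real"
  assumes "L > 0" and f: "continuous_on {0..L} f"
    and coeff: "\<And>m. ((\<lambda>x. f x * sin (real m * pi * x / L)) has_integral 0) {0..L}"
    and x: "x \<in> {0..L}"
  shows "f x = 0"
proof -
  define c where "c y = pi * y / L" for y
  have c_cont: "continuous_on S c" for S
    using \<open>L > 0\<close> unfolding c_def by (intro continuous_intros) auto
  \<comment> \<open>The moments need only \<open>m = 1\<close>, but the induction needs every
    \<open>m\<close>, because multiplying \<open>sin (m c)\<close> by \<open>cos c\<close> gives
    half the sum of the sines with \<open>m + 1\<close> and \<open>m - 1\<close>.\<close>
  have coeff': "(LBINT y:{0..L}. f y * (sin (real m * c y) * cos (c y) ^ k)) = 0" for m k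
  proof (induction k arbitrary: m)
    case 0
    have "set_integrable lborel {0..L} (\<lambda>y. f y * sin (real m * pi * y / L))"
      using \<open>L > 0\<close> by (intro borel_integrable_atLeastAtMost' continuous_intros f) auto
    from set_borel_integral_eq_integral(2)[OF this] integral_unique[OF coeff[of m]]
    show ?case
      by (simp add: c_def mult_ac)
  next
    case (Suc k)
    have int: "set_integrable lborel {0..L} (\<lambda>y. f y * (sin (real m * c y) * cos (c y) ^ k))" for m
      by (intro borel_integrable_atLeastAtMost' continuous_intros f c_cont)
    show ?case
    proof (cases m)
      case 0
      then show ?thesis
        by simp
    next
      case (Suc n)
      have "sin (real m * c y) * cos (c y) ^ Suc k
          = (sin (real (m + 1) * c y) * cos (c y) ^ k + sin (real n * c y) * cos (c y) ^ k) / 2" for y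
      proof -
        have "real (m + 1) * c y = real m * c y + c y" "real n * c y = real m * c y - c y"
          by (simp_all add: Suc algebra_simps)
        then show ?thesis
          by (simp only: sin_add sin_diff) (simp add: algebra_simps)
      qed
      then have "(LBINT y:{0..L}. f y * (sin (real m * c y) * cos (c y) ^ Suc k))
          = (LBINT y:{0..L}. (1/2) * (f y * (sin (real (m + 1) * c y) * cos (c y) ^ k)
              + f y * (sin (real n * c y) * cos (c y) ^ k)))"
        by (simp only: times_divide_eq_right distrib_left mult_1_left times_divide_eq_left add_divide_distrib)
      also have "\<dots> = 0"
        using Suc.IH[of "m + 1"] Suc.IH[of n] int[of "m + 1"] int[of n]
        by (simp add: set_integral_add)
      finally show ?thesis .
    qed
  qed
  define \<phi> where "\<phi> z = f (L / pi * arccos z)" for z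
  have \<phi>: "continuous_on {-1..1} \<phi>"
    unfolding \<phi>_def
  proof (rule continuous_on_compose2[OF f])
    show "continuous_on {-1..1} (\<lambda>z. L / pi * arccos z)"
      by (intro continuous_intros) auto
    show "(\<lambda>z. L / pi * arccos z) ` {-1..1} \<subseteq> {0..L}"
      using \<open>L > 0\<close> arccos_lbound arccos_ubound by (auto simp: field_simps mult_left_mono)
  qed
  define w where "w y = indicator {0..L} y * (f y * sin (c y))" for y
  have w: "integrable lborel w"
    using borel_integrable_atLeastAtMost'[of 0 L "\<lambda>y. f y * sin (c y)"] f c_cont[of "{0..L}"]
    by (simp add: w_def[abs_def] set_integrable_def continuous_intros)
  have "(\<integral>y. \<phi> (cos (c y)) * w y \<partial>lborel) = 0"
  proof (rule integral_continuous_eq_0_if_moments_eq_0[OF w _ _ _ \<phi>])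
    show "(\<lambda>y. cos (c y)) \<in> borel_measurable lborel"
      unfolding c_def by measurable
    show "cos (c y) \<in> {-1..1}" for y
      by simp
    show "(\<integral>y. cos (c y) ^ k * w y \<partial>lborel) = 0" for k
      using coeff'[of 1 k] by (simp add: w_def set_lebesgue_integral_def mult_ac)
  qed
  moreover have "\<phi> (cos (c y)) * w y = indicator {0..L} y *\<^sub>R ((f y)\<^sup>2 * sin (c y))" for y
  proof (cases "y \<in> {0..L}")
    case True
    then have "0 \<le> c y" "c y \<le> pi"
      using \<open>L > 0\<close> by (auto simp: c_def field_simps)
    then have "\<phi> (cos (c y)) = f y"
      using \<open>L > 0\<close> by (simp add: \<phi>_def arccos_cos) (simp add: c_def)
    then show ?thesis
      by (simp add: w_def power2_eq_square)
  qed (simp add: w_def)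
  ultimately have sq: "(LBINT y:{0..L}. (f y)\<^sup>2 * sin (c y)) = 0"
    by (simp add: set_lebesgue_integral_def)
  have sq_cont: "continuous_on {0..L} (\<lambda>y. (f y)\<^sup>2 * sin (c y))"
    by (intro continuous_intros f c_cont)
  have sq0: "(f y)\<^sup>2 * sin (c y) = 0" if "y \<in> {0..L}" for y
  proof (rule has_integral_0_cbox_imp_0[of 0 L "\<lambda>y. (f y)\<^sup>2 * sin (c y)"])
    show "((\<lambda>y. (f y)\<^sup>2 * sin (c y)) has_integral 0) (cbox 0 L)"
      using set_borel_integral_eq_integral[OF borel_integrable_atLeastAtMost'[OF sq_cont]] sq
      by (simp add: has_integral_iff)
    show "0 \<le> (f y)\<^sup>2 * sin (c y)" if "y \<in> box 0 L" for y
      using that \<open>L > 0\<close> by (intro mult_nonneg_nonneg sin_ge_zero) (auto simp: c_def field_simps box_real)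
  qed (use that sq_cont \<open>L > 0\<close> in \<open>auto simp: box_real\<close>)
  have inner: "f y = 0" if "y \<in> {0<..<L}" for y
  proof -
    have "sin (c y) > 0"
      using that \<open>L > 0\<close> by (intro sin_gt_zero) (auto simp: c_def field_simps)
    with sq0[of y] that show ?thesis
      by simp
  qed
  show ?thesis
    using continuous_constant_on_closure[of "{0<..<L}" f 0 x] f inner x \<open>L > 0\<close> by simp
qed

section \<open>Gaussian integrals\<close>

lemma
  fixes f :: "nat \<Rightarrow> real \<Rightarrow> real"
  assumes f: "\<And>n. continuous_on {a..b} (f n)"
    and M: "\<And>n x. x \<in> {a..b} \<Longrightarrow> \<bar>f n x\<bar> \<le> M n" "summable M"
  shows continuous_on_suminf_majorized: "continuous_on {a..b} (\<lambda>x. \<Sum>n. f n x)"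
    and sums_integral_majorized:
      "(\<And>n. (f n has_integral I n) {a..b}) \<Longrightarrow> I sums integral {a..b} (\<lambda>x. \<Sum>n. f n x)"
proof -
  have unif: "uniform_limit {a..b} (\<lambda>n x. \<Sum>i<n. f i x) (\<lambda>x. \<Sum>n. f n x) sequentially"
    by (rule Weierstrass_m_test) (use M in auto)
  have partial: "continuous_on {a..b} (\<lambda>x. \<Sum>i<n. f i x)" for n
    by (intro continuous_intros f)
  show "continuous_on {a..b} (\<lambda>x. \<Sum>n. f n x)"
    by (rule uniform_limit_theorem[OF _ unif]) (auto simp: partial)
  assume I: "\<And>n. (f n has_integral I n) {a..b}"
  obtain I' J where J: "\<And>n. ((\<lambda>x. \<Sum>i<n. f i x) has_integral I' n) {a..b}"
      "((\<lambda>x. \<Sum>n. f n x) has_integral J) {a..b}" "I' \<longlonglongrightarrow> J"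
    using uniform_limit_integral[OF unif partial] by auto
  have "I' n = (\<Sum>i<n. I i)" for n
    by (rule has_integral_unique[OF J(1)]) (intro has_integral_sum I finite_lessThan)
  then have "I' = (\<lambda>n. \<Sum>i<n. I i)"
    by blast
  with J show "I sums integral {a..b} (\<lambda>x. \<Sum>n. f n x)"
    by (simp add: sums_def integral_unique)
qed

section \<open>Sine transform of the odd Gaussian\<close>

text \<open>This is \<open>- c / 2\<close> times the derivative of
  \<open>exp (- (y\<^sup>2 / c))\<close>. At \<open>c = 4 * D11 * t\<close> it is a single image
  term, a spatial derivative of the heat kernel up to a factor depending on
  \<open>t\<close>.\<close>

definition odd_gauss :: "real \<Rightarrow> real \<Rightarrow> real" where
  "odd_gauss c y = y * exp (- (y\<^sup>2 / c))"

text \<open>Completing the square gives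
  \<open>exp (- (y\<^sup>2 / c)) \<le> exp (c - 2 * y)\<close>, and one factor
  \<open>exp (- y)\<close> absorbs \<open>y\<close>. The remaining exponent is linear in
  \<open>y\<close>, so equally spaced points get a geometric majorant.\<close>

lemma odd_gauss_bound:
  assumes "c > 0" and "y \<ge> 0"
  shows "\<bar>odd_gauss c y\<bar> \<le> exp c * exp (- y)"
proof -
  have "y\<^sup>2 / c - (2 * y - c) = (y - c)\<^sup>2 / c"
    using assms by (simp add: field_simps power2_eq_square)
  also have "\<dots> \<ge> 0"
    using assms by simp
  finally have "exp (- (y\<^sup>2 / c)) \<le> exp (c - 2 * y)"
    by simp
  moreover have "y \<le> exp y"
    using exp_ge_add_one_self[of y] by linarith
  ultimately have "y * exp (- (y\<^sup>2 / c)) \<le> exp y * exp (c - 2 * y)"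
    by (intro mult_mono) auto
  also have "\<dots> = exp c * exp (- y)"
    by (simp flip: exp_add)
  finally show ?thesis
    using assms by (simp add: odd_gauss_def abs_mult)
qed

text \<open>The real part of the characteristic function of the standard normal law, rescaled by
  \<open>a\<close> with \<open>a\<^sup>2 = 2 / c\<close> so that
  \<open>(a y)\<^sup>2 / 2 = y\<^sup>2 / c\<close>.\<close>

lemma gauss_cos_integral:
  fixes c \<omega> :: real
  assumes "c > 0"
  shows "has_bochner_integral lborel (\<lambda>y. exp (- (y\<^sup>2 / c)) * cos (\<omega> * y))
           (sqrt (pi * c) * exp (- (\<omega>\<^sup>2 * c / 4)))"
proof -
  define a where "a = sqrt (2 / c)"
  define t where "t = \<omega> / a"
  have a: "a > 0" "a\<^sup>2 = 2 / c"
    using assms by (simp_all add: a_def)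
  interpret real_distribution std_normal_distribution
    by (rule real_dist_normal_dist)
  have iexp: "integrable std_normal_distribution (\<lambda>z. iexp (t * z))"
    by (rule integrable_iexp) auto
  have "(LINT z|std_normal_distribution. Re (iexp (t * z))) = exp (- (t\<^sup>2 / 2))"
    using arg_cong[OF fun_cong[OF char_std_normal_distribution, of t], of Re]
    by (simp only: char_def integral_Re[OF iexp] Re_complex_of_real) simp
  moreover have "integrable std_normal_distribution (\<lambda>z. Re (iexp (t * z)))"
    using iexp by (rule integrable_Re)
  ultimately have "has_bochner_integral std_normal_distribution (\<lambda>z. cos (t * z)) (exp (- (t\<^sup>2 / 2)))"
    by (simp add: has_bochner_integral_iff Re_exp)
  then have "has_bochner_integral lborel (\<lambda>z. std_normal_density z * cos (t * z)) (exp (- (t\<^sup>2 / 2)))"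
    by (simp add: has_bochner_integral_iff integrable_density integral_density)
  then have "has_bochner_integral lborel
      (\<lambda>y. std_normal_density (0 + a * y) * cos (t * (0 + a * y))) (exp (- (t\<^sup>2 / 2)) /\<^sub>R \<bar>a\<bar>)"
    using a by (subst (asm) lborel_has_bochner_integral_real_affine_iff[of a _ _ 0]) auto
  then have "has_bochner_integral lborel
      (\<lambda>y. sqrt (2 * pi) * (std_normal_density (0 + a * y) * cos (t * (0 + a * y))))
      (sqrt (2 * pi) * (exp (- (t\<^sup>2 / 2)) /\<^sub>R \<bar>a\<bar>))"
    by (rule has_bochner_integral_mult_right)
  moreover have "sqrt (2 * pi) * (std_normal_density (0 + a * y) * cos (t * (0 + a * y)))
      = exp (- (y\<^sup>2 / c)) * cos (\<omega> * y)" for y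
    using a by (simp add: std_normal_density_def t_def power_mult_distrib)
  moreover have "sqrt (2 * pi) * (exp (- (t\<^sup>2 / 2)) /\<^sub>R \<bar>a\<bar>) = sqrt (pi * c) * exp (- (\<omega>\<^sup>2 * c / 4))"
  proof -
    have "t\<^sup>2 / 2 = \<omega>\<^sup>2 * c / 4"
      using a assms by (simp add: t_def power_divide)
    moreover have "sqrt (2 * pi) / a = sqrt (pi * c)"
      using assms by (simp add: a_def real_sqrt_divide[symmetric])
    ultimately show ?thesis
      using a by (simp add: field_simps)
  qed
  ultimately show ?thesis
    by simp
qed

text \<open>Evenness halves the integral over the line. The form as a limit of integrals over
  \<open>{0..R}\<close> suits the integration by parts to come.\<close>

lemma tendsto_integral_gauss_cos:
  fixes c \<omega> :: real
  assumes "c > 0"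
  shows "((\<lambda>R. integral {0..R} (\<lambda>y. exp (- (y\<^sup>2 / c)) * cos (\<omega> * y)))
           \<longlongrightarrow> sqrt (pi * c) / 2 * exp (- (\<omega>\<^sup>2 * c / 4))) at_top"
proof -
  let ?f = "\<lambda>y. exp (- (y\<^sup>2 / c)) * cos (\<omega> * y)"
  let ?h = "\<lambda>y. indicator {0..} y *\<^sub>R ?f y"
  have full: "has_bochner_integral lborel ?f (sqrt (pi * c) * exp (- (\<omega>\<^sup>2 * c / 4)))"
    by (rule gauss_cos_integral[OF assms])
  have half: "integrable lborel ?h"
    using full by (intro integrable_mult_indicator) (auto simp: has_bochner_integral_iff)
  have "has_bochner_integral lborel ?f (2 *\<^sub>R integral\<^sup>L lborel ?h)"
    by (rule has_bochner_integral_even_function) (use half in \<open>simp_all add: has_bochner_integral_iff\<close>)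
  from has_bochner_integral_eq[OF this full]
  have "integral\<^sup>L lborel ?h = sqrt (pi * c) / 2 * exp (- (\<omega>\<^sup>2 * c / 4))"
    by simp
  with tendsto_integral_at_top[OF sets_lborel half]
  have "((\<lambda>R. \<integral>y. indicator {..R} y *\<^sub>R ?h y \<partial>lborel)
      \<longlongrightarrow> sqrt (pi * c) / 2 * exp (- (\<omega>\<^sup>2 * c / 4))) at_top"
    by (simp only:)
  moreover have "(\<integral>y. indicator {..R} y *\<^sub>R ?h y \<partial>lborel) = integral {0..R} ?f" for R
  proof -
    have "indicator {..R} y *\<^sub>R ?h y = indicator {0..R} y *\<^sub>R ?f y" for y
      by (auto simp: indicator_def)
    moreover have "set_integrable lborel {0..R} ?f"
      using assms by (intro borel_integrable_atLeastAtMost' continuous_intros) auto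
    ultimately show ?thesis
      using set_borel_integral_eq_integral(2)[of "{0..R}" ?f]
      unfolding set_lebesgue_integral_def by (simp only:)
  qed
  ultimately show ?thesis
    by simp
qed

text \<open>Integration by parts, with \<open>odd_gauss c\<close> as a multiple of a derivative,
  reduces the sine to the cosine integral; the boundary term at \<open>R\<close> dies like
  \<open>exp (- (R\<^sup>2 / c))\<close>.\<close>

lemma tendsto_integral_odd_gauss_sin:
  fixes c \<omega> :: real
  assumes "c > 0"
  shows "((\<lambda>R. integral {0..R} (\<lambda>y. odd_gauss c y * sin (\<omega> * y)))
           \<longlongrightarrow> c * \<omega> / 4 * sqrt (pi * c) * exp (- (\<omega>\<^sup>2 * c / 4))) at_top"
proof -
  let ?e = "\<lambda>y. exp (- (y\<^sup>2 / c))"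
  have parts: "integral {0..R} (\<lambda>y. odd_gauss c y * sin (\<omega> * y))
      = c * \<omega> / 2 * integral {0..R} (\<lambda>y. ?e y * cos (\<omega> * y)) - c / 2 * (?e R * sin (\<omega> * R))"
    if "R \<ge> 0" for R
  proof -
    let ?F = "\<lambda>y. - (c / 2 * (?e y * sin (\<omega> * y)))"
    have "((\<lambda>y. odd_gauss c y * sin (\<omega> * y) - c * \<omega> / 2 * (?e y * cos (\<omega> * y)))
        has_integral ?F R - ?F 0) {0..R}"
    proof (rule fundamental_theorem_of_calculus[OF that])
      fix y
      have "(?F has_real_derivative odd_gauss c y * sin (\<omega> * y) - c * \<omega> / 2 * (?e y * cos (\<omega> * y)))
          (at y within {0..R})"
        using assms by (auto intro!: derivative_eq_intros simp: odd_gauss_def field_simps)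
      then show "(?F has_vector_derivative
          odd_gauss c y * sin (\<omega> * y) - c * \<omega> / 2 * (?e y * cos (\<omega> * y))) (at y within {0..R})"
        by (simp add: has_real_derivative_iff_has_vector_derivative)
    qed
    moreover have "((\<lambda>y. c * \<omega> / 2 * (?e y * cos (\<omega> * y))) has_integral
        c * \<omega> / 2 * integral {0..R} (\<lambda>y. ?e y * cos (\<omega> * y))) {0..R}"
      using assms
      by (intro has_integral_mult_right integrable_integral integrable_continuous_interval
          continuous_intros) auto
    ultimately have "((\<lambda>y. (odd_gauss c y * sin (\<omega> * y) - c * \<omega> / 2 * (?e y * cos (\<omega> * y)))
        + c * \<omega> / 2 * (?e y * cos (\<omega> * y))) has_integral
        (?F R - ?F 0) + c * \<omega> / 2 * integral {0..R} (\<lambda>y. ?e y * cos (\<omega> * y))) {0..R}"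
      by (rule has_integral_add)
    then show ?thesis
      by (simp add: integral_unique)
  qed
  have "((\<lambda>R. ?e R * sin (\<omega> * R)) \<longlongrightarrow> 0) at_top"
  proof (rule Lim_null_comparison)
    show "\<forall>\<^sub>F R in at_top. norm (?e R * sin (\<omega> * R)) \<le> ?e R"
      by (intro always_eventually allI) (simp add: abs_mult)
    show "(?e \<longlongrightarrow> 0) at_top"
      using assms by real_asymp
  qed
  then have "((\<lambda>R. c * \<omega> / 2 * integral {0..R} (\<lambda>y. ?e y * cos (\<omega> * y)) - c / 2 * (?e R * sin (\<omega> * R)))
      \<longlongrightarrow> c * \<omega> / 2 * (sqrt (pi * c) / 2 * exp (- (\<omega>\<^sup>2 * c / 4))) - c / 2 * 0) at_top"
    by (intro tendsto_intros tendsto_integral_gauss_cos assms)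
  then have "((\<lambda>R. c * \<omega> / 2 * integral {0..R} (\<lambda>y. ?e y * cos (\<omega> * y)) - c / 2 * (?e R * sin (\<omega> * R)))
      \<longlongrightarrow> c * \<omega> / 4 * sqrt (pi * c) * exp (- (\<omega>\<^sup>2 * c / 4))) at_top"
    by (simp add: mult.assoc)
  moreover have "\<forall>\<^sub>F R in at_top. c * \<omega> / 2 * integral {0..R} (\<lambda>y. ?e y * cos (\<omega> * y))
      - c / 2 * (?e R * sin (\<omega> * R)) = integral {0..R} (\<lambda>y. odd_gauss c y * sin (\<omega> * y))"
    using eventually_ge_at_top[of 0] by eventually_elim (simp only: parts)
  ultimately show ?thesis
    by (rule Lim_transform_eventually)
qed

section \<open>Laplace transform of a single image\<close>

lemma has_real_derivative_interval_integral:
  fixes f :: "real \<Rightarrow> real"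
  assumes "continuous_on UNIV f"
  shows "((\<lambda>z. LBINT y=ereal 0..ereal z. f y) has_real_derivative f z) (at z)"
proof -
  have "((\<lambda>z. LBINT y=ereal 0..ereal z. f y) has_vector_derivative f z)
      (at z within {- \<bar>z\<bar> - 1..\<bar>z\<bar> + 1})"
    by (rule interval_integral_FTC2) (auto intro: continuous_on_subset[OF assms])
  moreover have "at z within {- \<bar>z\<bar> - 1..\<bar>z\<bar> + 1} = at z"
    by (rule at_within_interior) auto
  ultimately show ?thesis
    by (simp add: has_real_derivative_iff_has_vector_derivative)
qed

text \<open>The witness is \<open>sqrt pi / 2\<close> times the error function; its limit at minus
  infinity follows from the one at infinity by oddness.\<close>

lemma gauss_antiderivative:
  obtains E :: "real \<Rightarrow> real"
  where "\<And>z. (E has_real_derivative exp (- z\<^sup>2)) (at z)"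
    and "(E \<longlongrightarrow> sqrt pi / 2) at_top" and "(E \<longlongrightarrow> - (sqrt pi / 2)) at_bot"
proof
  let ?g = "\<lambda>y::real. exp (- y\<^sup>2)"
  define E :: "real \<Rightarrow> real" where "E z = (LBINT y=ereal 0..ereal z. ?g y)" for z
  show deriv: "(E has_real_derivative ?g z) (at z)" for z
    unfolding E_def[abs_def]
    by (rule has_real_derivative_interval_integral) (auto intro!: continuous_intros)
  have half: "integrable lborel (\<lambda>y. indicator {0..} y *\<^sub>R ?g y)"
      "(\<integral>y. indicator {0..} y *\<^sub>R ?g y \<partial>lborel) = sqrt pi / 2"
    using gaussian_moment_0 by (auto simp: has_bochner_integral_iff)
  have "((\<lambda>z. \<integral>y. indicator {..z} y *\<^sub>R (indicator {0..} y *\<^sub>R ?g y) \<partial>lborel) \<longlongrightarrow> sqrt pi / 2) at_top"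
    using tendsto_integral_at_top[OF _ half(1)] half(2) by (simp only: sets_lborel)
  moreover have "\<forall>\<^sub>F z in at_top. (\<integral>y. indicator {..z} y *\<^sub>R (indicator {0..} y *\<^sub>R ?g y) \<partial>lborel) = E z"
    using eventually_ge_at_top[of 0]
  proof eventually_elim
    case (elim z)
    have "indicator {..z} y *\<^sub>R (indicator {0..} y *\<^sub>R ?g y) = indicator {0..z} y *\<^sub>R ?g y" for y
      by (auto simp: indicator_def)
    then show ?case
      using elim unfolding E_def by (simp only: interval_integral_Icc set_lebesgue_integral_def)
  qed
  ultimately show top: "(E \<longlongrightarrow> sqrt pi / 2) at_top"
    by (rule Lim_transform_eventually)
  have odd: "E (- z) = - E z" for z
  proof -
    have "((\<lambda>z. E z + E (- z)) has_real_derivative 0) (at z)" for z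
      by (rule derivative_eq_intros DERIV_chain'[OF _ deriv] deriv | simp)+
    then have "E z + E (- z) = E 0 + E (- 0)"
      using DERIV_isconst_all[of "\<lambda>z. E z + E (- z)" z 0] by simp
    also have "\<dots> = 0"
      by (simp add: E_def)
    finally show ?thesis
      by simp
  qed
  show "(E \<longlongrightarrow> - (sqrt pi / 2)) at_bot"
    using tendsto_minus[OF top] by (simp add: at_bot_mirror filterlim_filtermap odd)
qed

lemma inverse_gaussian_integral:
  fixes r q :: real
  assumes "r > 0" and "q > 0"
  shows "has_bochner_integral lborel
           (\<lambda>t. indicator {0<..} t * (r / (sqrt pi * t * sqrt t) * exp (- (r\<^sup>2 / t) - q\<^sup>2 * t)))
           (exp (- (2 * r * q)))"
proof -
  obtain E :: "real \<Rightarrow> real" where E: "\<And>z. (E has_real_derivative exp (- z\<^sup>2)) (at z)"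
      and top: "(E \<longlongrightarrow> sqrt pi / 2) at_top" and bot: "(E \<longlongrightarrow> - (sqrt pi / 2)) at_bot"
    using gauss_antiderivative by blast
  \<comment> \<open>\<open>u\<^sup>2 + 2 r q = v\<^sup>2 - 2 r q = r\<^sup>2 / t + q\<^sup>2 t\<close>, and \<open>u' + v' = - r / (t sqrt t)\<close> yields the prefactor.\<close>
  define u where "u t = r / sqrt t - q * sqrt t" for t
  define v where "v t = r / sqrt t + q * sqrt t" for t
  define e where "e = exp (- (2 * r * q))"
  define e' where "e' = exp (2 * r * q)"
  define F where "F t = - (e * E (u t) + e' * E (v t)) / sqrt pi" for t
  let ?f = "\<lambda>t. r / (sqrt pi * t * sqrt t) * exp (- (r\<^sup>2 / t) - q\<^sup>2 * t)"
  have F: "(F has_real_derivative ?f t) (at t)" if "t > 0" for t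
  proof -
    have u: "(u has_real_derivative - (r / (t * sqrt t) + q / sqrt t) / 2) (at t)"
      unfolding u_def[abs_def] using that
      by (auto intro!: derivative_eq_intros simp: field_simps)
    have v: "(v has_real_derivative - (r / (t * sqrt t) - q / sqrt t) / 2) (at t)"
      unfolding v_def[abs_def] using that
      by (auto intro!: derivative_eq_intros simp: field_simps)
    have sq: "(r / sqrt t)\<^sup>2 = r\<^sup>2 / t" "(q * sqrt t)\<^sup>2 = q\<^sup>2 * t" "r / sqrt t * (q * sqrt t) = r * q"
      using that by (simp_all add: power_divide power_mult_distrib)
    have eu: "e * exp (- (u t)\<^sup>2) = exp (- (r\<^sup>2 / t) - q\<^sup>2 * t)"
      using that by (simp add: e_def u_def power2_diff sq mult.assoc flip: exp_add)
    have ev: "e' * exp (- (v t)\<^sup>2) = exp (- (r\<^sup>2 / t) - q\<^sup>2 * t)"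
      using that by (simp add: e'_def v_def power2_sum sq mult.assoc flip: exp_add)
    have "(F has_real_derivative
        - (e * (exp (- (u t)\<^sup>2) * (- (r / (t * sqrt t) + q / sqrt t) / 2))
          + e' * (exp (- (v t)\<^sup>2) * (- (r / (t * sqrt t) - q / sqrt t) / 2))) / sqrt pi) (at t)"
      unfolding F_def[abs_def]
      by (intro DERIV_cdivide DERIV_minus DERIV_add DERIV_cmult DERIV_chain2[OF E] u v)
    moreover have "- (e * (exp (- (u t)\<^sup>2) * (- (r / (t * sqrt t) + q / sqrt t) / 2))
          + e' * (exp (- (v t)\<^sup>2) * (- (r / (t * sqrt t) - q / sqrt t) / 2))) / sqrt pi = ?f t"
      unfolding mult.assoc[symmetric] eu ev using that by (simp add: field_simps)
    ultimately show ?thesis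
      by simp
  qed
  \<comment> \<open>Only \<open>u\<close> changes sign between the two ends, so the
    \<open>e'\<close> contributions cancel and the jump of \<open>E (u t)\<close> by
    \<open>sqrt pi\<close> leaves exactly \<open>e\<close>. Since the integrand is nonnegative,
    these limits also yield integrability.\<close>
  have "((\<lambda>t. E (u t)) \<longlongrightarrow> sqrt pi / 2) (at_right 0)" "((\<lambda>t. E (v t)) \<longlongrightarrow> sqrt pi / 2) (at_right 0)"
      "((\<lambda>t. E (u t)) \<longlongrightarrow> - (sqrt pi / 2)) at_top" "((\<lambda>t. E (v t)) \<longlongrightarrow> sqrt pi / 2) at_top"
    unfolding u_def v_def using assms
    by (auto intro!: filterlim_compose[OF top] filterlim_compose[OF bot]) real_asymp+
  then have F0: "(F \<longlongrightarrow> - (e * (sqrt pi / 2) + e' * (sqrt pi / 2)) / sqrt pi) (at_right 0)"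
    and Finf: "(F \<longlongrightarrow> - (e * (- (sqrt pi / 2)) + e' * (sqrt pi / 2)) / sqrt pi) at_top"
    unfolding F_def[abs_def] by (intro tendsto_intros; simp)+
  have A: "((F \<circ> real_of_ereal) \<longlongrightarrow> - (e * (sqrt pi / 2) + e' * (sqrt pi / 2)) / sqrt pi) (at_right 0)"
    unfolding zero_ereal_def ereal_tendsto_simps by (rule F0)
  have B: "((F \<circ> real_of_ereal) \<longlongrightarrow> - (e * (- (sqrt pi / 2)) + e' * (sqrt pi / 2)) / sqrt pi) (at_left \<infinity>)"
    unfolding ereal_tendsto_simps by (rule Finf)
  have nonneg: "AE t in lborel. 0 < ereal t \<longrightarrow> ereal t < \<infinity> \<longrightarrow> 0 \<le> ?f t"
    using assms by auto
  have cont: "isCont ?f t" if "0 < ereal t" for t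
    using that by (intro continuous_intros) auto
  have F': "(F has_real_derivative ?f t) (at t)" if "0 < ereal t" for t
    using that F by simp
  have "set_integrable lborel (einterval 0 \<infinity>) ?f"
    "(LBINT t=0..\<infinity>. ?f t) = - (e * (- (sqrt pi / 2)) + e' * (sqrt pi / 2)) / sqrt pi
      - - (e * (sqrt pi / 2) + e' * (sqrt pi / 2)) / sqrt pi"
    by (rule interval_integral_FTC_nonneg[OF _ F' cont nonneg A B]; simp)+
  moreover have "einterval 0 \<infinity> = {0<..}"
    by (auto simp: einterval_def)
  moreover have "- (e * (- (sqrt pi / 2)) + e' * (sqrt pi / 2)) / sqrt pi
      - - (e * (sqrt pi / 2) + e' * (sqrt pi / 2)) / sqrt pi = e"
    by (simp add: field_simps)
  ultimately show ?thesis
    by (simp add: has_bochner_integral_iff set_integrable_def interval_lebesgue_integral_def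
        set_lebesgue_integral_def e_def)
qed

text \<open>The inverse Gaussian integral with \<open>r\<close> and \<open>q\<close> chosen so that
  \<open>r\<^sup>2 / t\<close> and \<open>q\<^sup>2 * t\<close> match the two exponents. The
  positivity of \<open>y\<close> is essential: at \<open>y = 0\<close> the left side is 0, while
  \<open>exp (- (b * y))\<close> is 1.\<close>

lemma odd_gauss_laplace:
  fixes D b y :: real
  assumes "D > 0" and "b > 0" and "y > 0"
  shows "has_bochner_integral lborel
           (\<lambda>t. indicator {0<..} t * (exp (- (D * b\<^sup>2 * t)) / (2 * sqrt (pi * D * t ^ 3))
             * odd_gauss (4 * D * t) y)) (exp (- (b * y)))"
proof -
  define r where "r = y / (2 * sqrt D)"
  define q where "q = b * sqrt D"
  have rq: "2 * r * q = b * y"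
    using assms by (simp add: r_def q_def)
  have "indicator {0<..} t * (r / (sqrt pi * t * sqrt t) * exp (- (r\<^sup>2 / t) - q\<^sup>2 * t))
      = indicator {0<..} t * (exp (- (D * b\<^sup>2 * t)) / (2 * sqrt (pi * D * t ^ 3))
             * odd_gauss (4 * D * t) y)" for t
  proof (cases "t > 0")
    case True
    have "sqrt (t ^ 3) = t * sqrt t"
      using True by (simp add: power3_eq_cube real_sqrt_mult)
    then have "sqrt (pi * D * t ^ 3) = sqrt pi * sqrt D * (t * sqrt t)"
      by (simp add: real_sqrt_mult)
    moreover have "r\<^sup>2 / t = y\<^sup>2 / (4 * D * t)" "q\<^sup>2 * t = D * b\<^sup>2 * t"
      using assms by (simp_all add: r_def q_def power_divide power_mult_distrib)
    ultimately show ?thesis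
      using True by (simp add: odd_gauss_def r_def exp_diff exp_minus field_simps)
  qed simp
  moreover have "r > 0" "q > 0"
    using assms by (simp_all add: r_def q_def)
  ultimately show ?thesis
    using inverse_gaussian_integral[of r q] by (simp only: rq)
qed

section \<open>Image series and pole series\<close>

text \<open>
  The images \<open>n\<close> and \<open>- n - 1\<close> of the series over \<open>\<int>\<close>. The second sits at the negative point
  \<open>x - 2 (n + 1) L\<close>; oddness turns it into a subtracted term at a positive point.
\<close>

definition image_pair :: "real \<Rightarrow> real \<Rightarrow> real \<Rightarrow> nat \<Rightarrow> real" where
  "image_pair L c x n = odd_gauss c (x + 2 * real n * L) - odd_gauss c (2 * real (Suc n) * L - x)"

section \<open>Decay and sine coefficients of the image series\<close>

text \<open>For \<open>x\<close> in the closed interval both points of the \<open>n\<close>-th pair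
  lie at or beyond \<open>2 * n * L\<close>, so one geometric majorant works uniformly in
  \<open>x\<close>.\<close>

lemma odd_gauss_image_bounds:
  assumes "c > 0" and "x \<in> {0..L}"
  shows "\<bar>odd_gauss c (x + 2 * real n * L)\<bar> \<le> exp c * exp (- (2 * L)) ^ n"
    and "\<bar>odd_gauss c (2 * real (Suc n) * L - x)\<bar> \<le> exp c * exp (- (2 * L)) ^ n"
proof -
  have L: "L \<ge> 0"
    using assms by simp
  have bound: "\<bar>odd_gauss c y\<bar> \<le> exp c * exp (- (2 * L)) ^ n" if "y \<ge> 2 * real n * L" for y
  proof -
    have "y \<ge> 0"
      using L by (intro order_trans[OF _ that]) simp
    with assms have "\<bar>odd_gauss c y\<bar> \<le> exp c * exp (- y)"
      by (intro odd_gauss_bound)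
    also have "\<dots> \<le> exp c * exp (- (2 * real n * L))"
      using that by simp
    also have "exp (- (2 * real n * L)) = exp (- (2 * L)) ^ n"
      by (simp add: exp_of_nat_mult[symmetric] mult_ac)
    finally show ?thesis .
  qed
  show "\<bar>odd_gauss c (x + 2 * real n * L)\<bar> \<le> exp c * exp (- (2 * L)) ^ n"
    by (rule bound) (use assms in simp)
  show "\<bar>odd_gauss c (2 * real (Suc n) * L - x)\<bar> \<le> exp c * exp (- (2 * L)) ^ n"
    by (rule bound) (use assms in \<open>simp add: algebra_simps\<close>)
qed

lemma image_pair_bound:
  assumes "c > 0" and "x \<in> {0..L}"
  shows "\<bar>image_pair L c x n\<bar> \<le> 2 * exp c * exp (- (2 * L)) ^ n"
  using odd_gauss_image_bounds[OF assms, of n] unfolding image_pair_def by linarith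

lemma summable_exp_power: "a > 0 \<Longrightarrow> summable (\<lambda>n. K * exp (- a) ^ n)" for K a :: real
  by (intro summable_mult summable_geometric) simp

lemma summable_image_pair:
  assumes "L > 0" and "c > 0" and "x \<in> {0..L}"
  shows "summable (\<lambda>n. \<bar>image_pair L c x n\<bar>)"
  by (rule summable_comparison_test'[OF summable_exp_power[of "2 * L" "2 * exp c"]])
    (use assms image_pair_bound in auto)

lemma continuous_on_odd_gauss: "c > 0 \<Longrightarrow> continuous_on S (odd_gauss c)"
  unfolding odd_gauss_def[abs_def] by (intro continuous_intros) auto

lemma continuous_on_image_pair: "c > 0 \<Longrightarrow> continuous_on S (\<lambda>x. image_pair L c x n)"
  unfolding image_pair_def
  by (intro continuous_intros continuous_on_compose2[OF continuous_on_odd_gauss[of c UNIV]]) auto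

lemma image_series_sine_coefficient:
  fixes m :: nat
  assumes "L > 0" and "c > 0"
  defines "\<omega> \<equiv> real m * pi / L"
  shows "((\<lambda>x. (\<Sum>n. image_pair L c x n) * sin (real m * pi * x / L)) has_integral
           c * \<omega> / 4 * sqrt (pi * c) * exp (- (\<omega>\<^sup>2 * c / 4))) {0..L}"
proof -
  let ?S = "\<lambda>y. sin (real m * pi * y / L)"
  let ?k = "\<lambda>y. odd_gauss c y * ?S y"
  let ?f = "\<lambda>n x. image_pair L c x n * ?S x"
  let ?M = "\<lambda>n. 2 * exp c * exp (- (2 * L)) ^ n"
  have k_cont: "continuous_on A ?k" for A
    using assms by (intro continuous_intros continuous_on_odd_gauss) auto
  \<comment> \<open>Since \<open>sin (m \<pi> y / L)\<close> is \<open>2 L\<close>-periodic and odd, the integrals over the image pairs tile the half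
    line: they telescope in the antiderivative \<open>P\<close>.\<close>
  define P :: "real \<Rightarrow> real" where "P z = (LBINT y=ereal 0..ereal z. ?k y)" for z
  have P: "(P has_real_derivative ?k z) (at z)" for z
    unfolding P_def[abs_def] by (rule has_real_derivative_interval_integral[OF k_cont])
  have P_eq: "P R = integral {0..R} ?k" if "R \<ge> 0" for R
    using that unfolding P_def
    by (intro interval_integral_eq_integral borel_integrable_atLeastAtMost' k_cont) auto
  have P_lim: "(P \<longlongrightarrow> c * \<omega> / 4 * sqrt (pi * c) * exp (- (\<omega>\<^sup>2 * c / 4))) at_top"
  proof (rule Lim_transform_eventually[OF tendsto_integral_odd_gauss_sin[OF \<open>c > 0\<close>, of \<omega>]])
    show "\<forall>\<^sub>F R in at_top. integral {0..R} (\<lambda>y. odd_gauss c y * sin (\<omega> * y)) = P R"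
      using eventually_ge_at_top[of 0] by eventually_elim (simp add: P_eq \<omega>_def)
  qed
  have S_shift: "?S (x + 2 * real n * L) = ?S x" for n x
  proof -
    have "real m * pi * (x + 2 * real n * L) / L = real m * pi * x / L + real (m * n) * (2 * pi)"
      using assms by (simp add: field_simps)
    then show ?thesis
      using sin_integer_2pi[of "real (m * n)"] cos_integer_2pi[of "real (m * n)"]
      by (simp only: sin_add) (simp add: mult.commute)
  qed
  have S_reflect: "?S (2 * real (Suc n) * L - x) = - ?S x" for n x
    using S_shift[of "- x" "Suc n"] by (simp add: algebra_simps)
  have I: "(?f n has_integral P (2 * real (Suc n) * L) - P (2 * real n * L)) {0..L}" for n
  proof -
    \<comment> \<open>As \<open>x\<close> runs over \<open>{0..L}\<close>, the first image sweeps
      \<open>2nL\<close> to \<open>(2n+1)L\<close> and the reflected one sweeps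
      \<open>(2n+1)L\<close> to \<open>(2n+2)L\<close>. At \<open>x = L\<close> the two values of
      \<open>P\<close> coincide, so \<open>?F L = 0\<close> and only the outer endpoints
      survive.\<close>
    let ?F = "\<lambda>x. P (x + 2 * real n * L) - P (2 * real (Suc n) * L - x)"
    have "(?f n has_integral ?F L - ?F 0) {0..L}"
    proof (rule fundamental_theorem_of_calculus)
      fix x
      have "(?F has_real_derivative ?k (x + 2 * real n * L) * (1 + 0)
          - ?k (2 * real (Suc n) * L - x) * (0 - 1)) (at x)"
        by (intro DERIV_diff DERIV_chain2[OF P] DERIV_add DERIV_ident DERIV_const)
      moreover have "?k (x + 2 * real n * L) * (1 + 0) - ?k (2 * real (Suc n) * L - x) * (0 - 1) = ?f n x"
        unfolding S_shift S_reflect image_pair_def by (simp add: algebra_simps)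
      ultimately show "(?F has_vector_derivative ?f n x) (at x within {0..L})"
        by (simp add: has_real_derivative_iff_has_vector_derivative has_vector_derivative_at_within)
    qed (use assms in simp)
    then show ?thesis
      by (simp add: algebra_simps)
  qed
  have f_cont: "continuous_on {0..L} (?f n)" for n
    using assms by (intro continuous_intros continuous_on_image_pair) auto
  have L2: "2 * L > 0"
    using assms by simp
  have f_bound: "\<bar>?f n x\<bar> \<le> ?M n" if "x \<in> {0..L}" for n x
  proof -
    have "\<bar>?f n x\<bar> \<le> \<bar>image_pair L c x n\<bar>"
      by (simp add: abs_mult mult_left_le)
    also have "\<dots> \<le> ?M n"
      by (rule image_pair_bound[OF \<open>c > 0\<close> that])
    finally show ?thesis .
  qed
  have "(\<lambda>n. P (2 * real (Suc n) * L) - P (2 * real n * L)) sums integral {0..L} (\<lambda>x. \<Sum>n. ?f n x)"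
    by (rule sums_integral_majorized[OF f_cont f_bound summable_exp_power[OF L2] I])
  moreover have "(\<lambda>n. P (2 * real (Suc n) * L) - P (2 * real n * L)) sums
      (c * \<omega> / 4 * sqrt (pi * c) * exp (- (\<omega>\<^sup>2 * c / 4)) - P (2 * real 0 * L))"
  proof (rule telescope_sums)
    have "filterlim (\<lambda>n. 2 * real n * L) at_top sequentially"
      using \<open>L > 0\<close> by real_asymp
    then show "(\<lambda>n. P (2 * real n * L)) \<longlonglongrightarrow> c * \<omega> / 4 * sqrt (pi * c) * exp (- (\<omega>\<^sup>2 * c / 4))"
      by (rule filterlim_compose[OF P_lim])
  qed
  moreover have "P 0 = 0"
    by (simp add: P_eq)
  ultimately have "integral {0..L} (\<lambda>x. \<Sum>n. ?f n x) = c * \<omega> / 4 * sqrt (pi * c) * exp (- (\<omega>\<^sup>2 * c / 4))"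
    using sums_unique2 by fastforce
  moreover have "(\<lambda>x. \<Sum>n. ?f n x) integrable_on {0..L}"
    by (intro integrable_continuous_interval
        continuous_on_suminf_majorized[OF f_cont f_bound summable_exp_power[OF L2]])
  ultimately have "((\<lambda>x. \<Sum>n. ?f n x) has_integral
      c * \<omega> / 4 * sqrt (pi * c) * exp (- (\<omega>\<^sup>2 * c / 4))) {0..L}"
    by (simp only: has_integral_iff)
  moreover have "(\<Sum>n. ?f n x) = (\<Sum>n. image_pair L c x n) * ?S x" if "x \<in> {0..L}" for x
    using summable_image_pair[OF assms(1,2) that]
    by (intro suminf_mult2[symmetric]) (auto intro: summable_rabs_cancel)
  ultimately show ?thesis
    by (rule has_integral_eq[rotated])
qed

section \<open>Sine series and equality of the two expansions\<close>

text \<open>By product-to-sum the integrand splits into cosines of integer frequencies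
  \<open>i - j\<close> and \<open>i + j + 2\<close>. The successors keep the second one nonzero, so
  a contribution arises only for \<open>i = j\<close>.\<close>

lemma has_integral_sin_mult_sin:
  fixes i j :: nat
  assumes "L > 0"
  shows "((\<lambda>x. sin (real (Suc i) * pi * x / L) * sin (real (Suc j) * pi * x / L)) has_integral
           (if i = j then L / 2 else 0)) {0..L}"
proof -
  have cos_int: "((\<lambda>x. cos (of_int k * (pi * x / L))) has_integral (if k = 0 then L else 0)) {0..L}"
    for k :: int
  proof (cases "k = 0")
    case True
    then show ?thesis
      using has_integral_const_real[of "1::real" 0 L] assms by simp
  next
    case False
    let ?F = "\<lambda>x. L / (of_int k * pi) * sin (of_int k * (pi * x / L))"
    have "((\<lambda>x. cos (of_int k * (pi * x / L))) has_integral ?F L - ?F 0) {0..L}"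
    proof (rule fundamental_theorem_of_calculus)
      fix x
      have "(?F has_real_derivative cos (of_int k * (pi * x / L))) (at x within {0..L})"
        using False assms by (auto intro!: derivative_eq_intros)
      then show "(?F has_vector_derivative cos (of_int k * (pi * x / L))) (at x within {0..L})"
        by (simp add: has_real_derivative_iff_has_vector_derivative)
    qed (use assms in simp)
    with False assms show ?thesis
      by (simp add: sin_int_times_real mult.commute)
  qed
  have eq: "sin (real (Suc i) * pi * x / L) * sin (real (Suc j) * pi * x / L)
      = (cos (of_int (int i - int j) * (pi * x / L)) - cos (of_int (int i + int j + 2) * (pi * x / L))) / 2"
    for x
  proof -
    have "of_int (int i - int j) * (pi * x / L) = real (Suc i) * pi * x / L - real (Suc j) * pi * x / L"
      "of_int (int i + int j + 2) * (pi * x / L) = real (Suc i) * pi * x / L + real (Suc j) * pi * x / L"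
      by (simp_all add: algebra_simps add_divide_distrib diff_divide_distrib)
    then show ?thesis
      by (simp only: cos_add cos_diff) simp
  qed
  show ?thesis
    unfolding eq
    by (rule has_integral_eq_rhs[OF has_integral_divide[OF has_integral_diff[OF cos_int cos_int]]]) auto
qed

lemma sine_series_coefficient:
  assumes "L > 0" and d: "summable (\<lambda>k. \<bar>d k\<bar>)"
  shows "((\<lambda>x. (\<Sum>k. d k * sin (real (Suc k) * pi * x / L)) * sin (real (Suc j) * pi * x / L))
           has_integral d j * L / 2) {0..L}"
proof -
  let ?S = "\<lambda>k x. sin (real (Suc k) * pi * x / L)"
  let ?f = "\<lambda>k x. d k * ?S k x * ?S j x"
  have f_cont: "continuous_on {0..L} (?f k)" for k
    using assms by (intro continuous_intros) auto
  have f_bound: "\<bar>?f k x\<bar> \<le> \<bar>d k\<bar>" if "x \<in> {0..L}" for k x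
    by (simp add: abs_mult mult_left_le mult_le_one mult.assoc)
  have I: "(?f k has_integral d k * (if k = j then L / 2 else 0)) {0..L}" for k
    unfolding mult.assoc[of "d k"]
    by (intro has_integral_mult_right has_integral_sin_mult_sin assms)
  have "(\<lambda>k. d k * (if k = j then L / 2 else 0)) sums integral {0..L} (\<lambda>x. \<Sum>k. ?f k x)"
    by (rule sums_integral_majorized[OF f_cont f_bound d I])
  moreover have "(\<lambda>k. if k = j then d k * (L / 2) else 0) sums (d j * (L / 2))"
    by (rule sums_single)
  moreover have "(\<lambda>k. d k * (if k = j then L / 2 else 0)) = (\<lambda>k. if k = j then d k * (L / 2) else 0)"
    by auto
  ultimately have "integral {0..L} (\<lambda>x. \<Sum>k. ?f k x) = d j * L / 2"
    using sums_unique2 by fastforce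
  moreover have "(\<lambda>x. \<Sum>k. ?f k x) integrable_on {0..L}"
    by (intro integrable_continuous_interval continuous_on_suminf_majorized[OF f_cont f_bound d])
  moreover have "(\<Sum>k. ?f k x) = (\<Sum>k. d k * ?S k x) * ?S j x" for x
  proof (rule suminf_mult2[symmetric])
    show "summable (\<lambda>k. d k * ?S k x)"
      by (rule summable_comparison_test'[OF d]) (simp add: abs_mult mult_left_le)
  qed
  ultimately show ?thesis
    by (simp add: has_integral_integrable_integral)
qed

text \<open>A Poisson summation identity, of the type of a differentiated theta function. The factor
  \<open>2 / L\<close> in \<open>d\<close> normalizes the sine coefficients, since each sine has
  square integral \<open>L / 2\<close>.\<close>

lemma image_series_eq_sine_series:
  assumes "L > 0" and "c > 0" and x: "x \<in> {0..L}"
  defines "\<omega> \<equiv> \<lambda>m. real m * pi / L"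
  defines "d \<equiv> \<lambda>k. 2 / L * (c * \<omega> (Suc k) / 4 * sqrt (pi * c) * exp (- ((\<omega> (Suc k))\<^sup>2 * c / 4)))"
  shows "summable (\<lambda>k. d k * sin (real (Suc k) * pi * x / L))"
    and "(\<Sum>n. image_pair L c x n) = (\<Sum>k. d k * sin (real (Suc k) * pi * x / L))"
proof -
  \<comment> \<open>\<open>c'\<close> is the dual width:
    \<open>\<omega>\<^sup>2 * c / 4 = (k + 1)\<^sup>2 / c'\<close>. The sine transform of an odd
    Gaussian is again an odd Gaussian, so the earlier decay bound also gives summability of the
    coefficients.\<close>
  define c' where "c' = 4 * L\<^sup>2 / (pi\<^sup>2 * c)"
  define K where "K = c * sqrt (pi * c) * pi / (2 * L\<^sup>2)"
  have "c' > 0" "K > 0"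
    using assms by (simp_all add: c'_def K_def)
  have d_eq: "d k = K * odd_gauss c' (real (Suc k))" for k
  proof -
    have "(\<omega> (Suc k))\<^sup>2 * c / 4 = (real (Suc k))\<^sup>2 / c'"
      using assms(1,2)
      by (simp add: c'_def \<omega>_def power_mult_distrib power_divide field_simps del: of_nat_Suc)
    then show ?thesis
      unfolding d_def odd_gauss_def K_def
      by (simp only:) (simp add: \<omega>_def power2_eq_square del: of_nat_Suc)
  qed
  have "\<bar>d k\<bar> \<le> K * exp c' * exp (- 1) ^ k" for k
  proof -
    have "\<bar>odd_gauss c' (real (Suc k))\<bar> \<le> exp c' * exp (- real (Suc k))"
      by (rule odd_gauss_bound) (use \<open>c' > 0\<close> in auto)
    also have "\<dots> \<le> exp c' * exp (- real k)"
      by simp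
    also have "exp (- real k) = exp (- 1) ^ k"
      by (simp add: exp_of_nat_mult[symmetric])
    finally show ?thesis
      using \<open>K > 0\<close> by (simp add: d_eq abs_mult mult.assoc)
  qed
  then have d: "summable (\<lambda>k. \<bar>d k\<bar>)"
    by (intro summable_comparison_test'[OF summable_exp_power[of 1 "K * exp c'"]]) auto
  let ?s = "\<lambda>k x. d k * sin (real (Suc k) * pi * x / L)"
  have s_bound: "\<bar>?s k x\<bar> \<le> \<bar>d k\<bar>" for k x
    by (simp add: abs_mult mult_left_le)
  show "summable (\<lambda>k. ?s k x)"
    by (rule summable_comparison_test'[OF d]) (use s_bound in simp)
  define h where "h y = (\<Sum>n. image_pair L c y n) - (\<Sum>k. ?s k y)" for y
  have "h x = 0"
  proof (rule continuous_eq_0_if_sine_coefficients_eq_0[OF \<open>L > 0\<close> _ _ x])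
    have "continuous_on {0..L} (\<lambda>y. \<Sum>n. image_pair L c y n)"
      by (rule continuous_on_suminf_majorized[OF continuous_on_image_pair image_pair_bound
            summable_exp_power]) (use assms in auto)
    moreover have "continuous_on {0..L} (\<lambda>y. \<Sum>k. ?s k y)"
      by (rule continuous_on_suminf_majorized[OF _ s_bound d])
        (use assms in \<open>auto intro!: continuous_intros\<close>)
    ultimately show "continuous_on {0..L} h"
      unfolding h_def by (rule continuous_on_diff)
    show "((\<lambda>y. h y * sin (real m * pi * y / L)) has_integral 0) {0..L}" for m
    proof (cases m)
      case (Suc j)
      have "((\<lambda>y. (\<Sum>n. image_pair L c y n) * sin (real (Suc j) * pi * y / L)
            - (\<Sum>k. ?s k y) * sin (real (Suc j) * pi * y / L)) has_integral
          c * \<omega> (Suc j) / 4 * sqrt (pi * c) * exp (- ((\<omega> (Suc j))\<^sup>2 * c / 4)) - d j * L / 2) {0..L}"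
        unfolding \<omega>_def
        by (intro has_integral_diff image_series_sine_coefficient sine_series_coefficient d assms)
      moreover have "d j * L / 2 = c * \<omega> (Suc j) / 4 * sqrt (pi * c) * exp (- ((\<omega> (Suc j))\<^sup>2 * c / 4))"
      proof -
        have "2 / L * X * L / 2 = X" for X
          using \<open>L > 0\<close> by simp
        then show ?thesis
          unfolding d_def .
      qed
      ultimately show ?thesis
        by (simp add: Suc h_def left_diff_distrib)
    qed simp
  qed
  then show "(\<Sum>n. image_pair L c x n) = (\<Sum>k. ?s k x)"
    by (simp add: h_def)
qed

section \<open>Laplace transform of the image series\<close>

text \<open>Both points of each pair are positive, so the two kernels are nonnegative and the
  integral of \<open>\<bar>f n t\<bar>\<close> is at most the sum of their transforms. These are
  geometric with ratio \<rho>, which permits exchanging sum and integral. The resulting sum gives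
  the quotient of hyperbolic sines after cancelling \<open>exp (- (L * b))\<close>.\<close>

lemma image_series_laplace:
  fixes D L b x :: real
  assumes "D > 0" and "L > 0" and "b > 0" and "0 < x" and "x \<le> L"
  shows "has_bochner_integral lborel
           (\<lambda>t. indicator {0<..} t * (exp (- (D * b\<^sup>2 * t)) / (2 * sqrt (pi * D * t ^ 3))
             * (\<Sum>n. image_pair L (4 * D * t) x n))) (sinh ((L - x) * b) / sinh (L * b))"
proof -
  let ?w = "\<lambda>t. indicator {0<..} t * (exp (- (D * b\<^sup>2 * t)) / (2 * sqrt (pi * D * t ^ 3)))"
  let ?k = "\<lambda>y t. indicator {0<..} t * (exp (- (D * b\<^sup>2 * t)) / (2 * sqrt (pi * D * t ^ 3))
      * odd_gauss (4 * D * t) y)"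
  let ?y = "\<lambda>n. x + 2 * real n * L" and ?z = "\<lambda>n. 2 * real (Suc n) * L - x"
  define f where "f n t = ?k (?y n) t - ?k (?z n) t" for n t
  define \<rho> where "\<rho> = exp (- (2 * (L * b)))"
  have \<rho>: "0 < \<rho>" "\<rho> < 1"
    using assms by (simp_all add: \<rho>_def)
  have y: "?y n > 0" for n
    using assms by (intro add_pos_nonneg) auto
  have z: "?z n > 0" for n
  proof -
    have "?z n = 2 * real n * L + L + (L - x)"
      by (simp add: algebra_simps)
    also have "\<dots> > 0"
      using assms by (intro add_pos_nonneg add_nonneg_pos) auto
    finally show ?thesis .
  qed
  have ky: "has_bochner_integral lborel (?k (?y n)) (exp (- (b * x)) * \<rho> ^ n)" for n
  proof -
    have "exp (- (b * ?y n)) = exp (- (b * x)) * \<rho> ^ n"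
      by (simp add: \<rho>_def algebra_simps flip: exp_of_nat_mult exp_add)
    with odd_gauss_laplace[OF assms(1,3) y[of n]] show ?thesis
      by simp
  qed
  have kz: "has_bochner_integral lborel (?k (?z n)) (exp (- (b * (2 * L - x))) * \<rho> ^ n)" for n
  proof -
    have "exp (- (b * ?z n)) = exp (- (b * (2 * L - x))) * \<rho> ^ n"
      by (simp add: \<rho>_def algebra_simps flip: exp_of_nat_mult exp_add)
    with odd_gauss_laplace[OF assms(1,3) z[of n]] show ?thesis
      by simp
  qed
  let ?V = "\<lambda>n. exp (- (b * x)) * \<rho> ^ n - exp (- (b * (2 * L - x))) * \<rho> ^ n"
  let ?W = "\<lambda>n. exp (- (b * x)) * \<rho> ^ n + exp (- (b * (2 * L - x))) * \<rho> ^ n"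
  have f: "has_bochner_integral lborel (f n) (?V n)" for n
    unfolding f_def[abs_def] by (rule has_bochner_integral_diff[OF ky kz])
  have f_eq: "f n t = ?w t * image_pair L (4 * D * t) x n" for n t
    by (simp add: f_def image_pair_def algebra_simps)
  have summ: "summable (\<lambda>n. \<bar>image_pair L (4 * D * t) x n\<bar>)" if "t > 0" for t
    by (rule summable_image_pair) (use assms that in auto)
  have AE_summ: "AE t in lborel. summable (\<lambda>n. norm (f n t))"
  proof (rule AE_I2)
    fix t
    show "summable (\<lambda>n. norm (f n t))"
    proof (cases "t > 0")
      case True
      then show ?thesis
        unfolding f_eq real_norm_def abs_mult by (intro summable_mult summ)
    qed (simp add: f_eq)
  qed
  have W: "summable ?W"
    using \<rho> by (intro summable_add summable_mult summable_geometric) simp_all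
  have norm_summ: "summable (\<lambda>n. \<integral>t. norm (f n t) \<partial>lborel)"
  proof (rule summable_comparison_test'[OF W])
    fix n
    have k_nonneg: "?k y t \<ge> 0" if "y > 0" for y t
      using that assms by (auto simp: indicator_def odd_gauss_def)
    have "(\<integral>t. norm (f n t) \<partial>lborel) \<le> (\<integral>t. ?k (?y n) t + ?k (?z n) t \<partial>lborel)"
    proof (rule integral_mono)
      show "integrable lborel (\<lambda>t. norm (f n t))"
        using f by (intro integrable_norm) (auto simp: has_bochner_integral_iff)
      show "integrable lborel (\<lambda>t. ?k (?y n) t + ?k (?z n) t)"
        using has_bochner_integral_add[OF ky kz] by (auto simp: has_bochner_integral_iff)
      show "norm (f n t) \<le> ?k (?y n) t + ?k (?z n) t" for t
        using k_nonneg[OF y[of n], of t] k_nonneg[OF z[of n], of t]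
        unfolding f_def real_norm_def by linarith
    qed
    also have "\<dots> = ?W n"
      using has_bochner_integral_add[OF ky kz] by (rule has_bochner_integral_integral_eq)
    finally show "norm (\<integral>t. norm (f n t) \<partial>lborel) \<le> ?W n"
      by simp
  qed
  have f_int: "integrable lborel (f n)" for n
    using f by (auto simp: has_bochner_integral_iff)
  have "has_bochner_integral lborel (\<lambda>t. \<Sum>n. f n t) (\<Sum>n. integral\<^sup>L lborel (f n))"
    using integrable_suminf[OF f_int AE_summ norm_summ] integral_suminf[OF f_int AE_summ norm_summ]
    by (simp add: has_bochner_integral_iff)
  moreover have "integral\<^sup>L lborel (f n) = ?V n" for n
    using f by (rule has_bochner_integral_integral_eq)
  moreover have "(\<Sum>n. ?V n) = sinh ((L - x) * b) / sinh (L * b)"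
  proof -
    have "?V sums (exp (- (b * x)) * (1 / (1 - \<rho>)) - exp (- (b * (2 * L - x))) * (1 / (1 - \<rho>)))"
      using \<rho> by (intro sums_diff sums_mult geometric_sums) simp_all
    then have "(\<Sum>n. ?V n) = (exp (- (b * x)) - exp (- (b * (2 * L - x)))) / (1 - \<rho>)"
      by (simp add: sums_iff diff_divide_distrib)
    also have "exp (- (b * x)) - exp (- (b * (2 * L - x))) = exp (- (L * b)) * (2 * sinh ((L - x) * b))"
      by (simp add: sinh_field_def algebra_simps flip: exp_add)
    also have "1 - \<rho> = exp (- (L * b)) * (2 * sinh (L * b))"
      by (simp add: \<rho>_def sinh_field_def algebra_simps flip: exp_add)
    also have "exp (- (L * b)) * (2 * sinh ((L - x) * b)) / (exp (- (L * b)) * (2 * sinh (L * b)))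
        = sinh ((L - x) * b) / sinh (L * b)"
      by simp
    finally show ?thesis .
  qed
  moreover have "(\<Sum>n. f n t) = indicator {0<..} t * (exp (- (D * b\<^sup>2 * t)) / (2 * sqrt (pi * D * t ^ 3))
      * (\<Sum>n. image_pair L (4 * D * t) x n))" for t
  proof (cases "t > 0")
    case True
    then show ?thesis
      unfolding f_eq mult.assoc[symmetric]
      by (intro suminf_mult) (use summ in \<open>auto intro: summable_rabs_cancel\<close>)
  qed (simp add: f_eq)
  ultimately show ?thesis
    by simp
qed

text \<open>Each half of the pairs is absolutely summable on its own, so the sum over the integers
  splits into \<open>n \<ge> 0\<close> and \<open>n < 0\<close>. The map \<open>- int n - 1\<close>
  starts at -1 and lists the negative integers once each.\<close>

lemma has_sum_image_term:
  assumes "D11 > 0" and "L > 0" and x: "x \<in> {0..L}" and "t > 0"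
  shows "(image_term D11 L x t has_sum (\<Sum>n. image_pair L (4 * D11 * t) x n)) UNIV"
proof -
  let ?c = "4 * D11 * t"
  let ?p = "\<lambda>n. odd_gauss ?c (x + 2 * real n * L)" and ?q = "\<lambda>n. odd_gauss ?c (2 * real (Suc n) * L - x)"
  have c: "?c > 0" and L2: "2 * L > 0"
    using assms by simp_all
  have summ: "summable (\<lambda>n. norm (?p n))" "summable (\<lambda>n. norm (- ?q n))"
    by (rule summable_comparison_test'[OF summable_exp_power[OF L2, of "exp ?c"]];
        use odd_gauss_image_bounds[OF c x] in simp)+
  have sums: "?p sums (\<Sum>n. ?p n)" "(\<lambda>n. - ?q n) sums (\<Sum>n. - ?q n)"
    using summ by (auto intro!: summable_sums intro: summable_norm_cancel)
  have "(?p has_sum (\<Sum>n. ?p n)) UNIV"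
    by (rule norm_summable_imp_has_sum[OF summ(1) sums(1)])
  moreover have "?p = image_term D11 L x t \<circ> int"
    by (auto simp: image_term_def odd_gauss_def fun_eq_iff)
  ultimately have pos: "(image_term D11 L x t has_sum (\<Sum>n. ?p n)) (range int)"
    by (subst has_sum_reindex) (auto simp: inj_on_def)
  have "((\<lambda>n. - ?q n) has_sum (\<Sum>n. - ?q n)) UNIV"
    by (rule norm_summable_imp_has_sum[OF summ(2) sums(2)])
  moreover have "(\<lambda>n. - ?q n) = image_term D11 L x t \<circ> (\<lambda>n. - int n - 1)"
  proof
    fix n
    have "x + 2 * of_int (- int n - 1) * L = - (2 * real (Suc n) * L - x)"
      by (simp add: algebra_simps)
    then show "- ?q n = (image_term D11 L x t \<circ> (\<lambda>n. - int n - 1)) n"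
      unfolding comp_def image_term_def odd_gauss_def by (simp only: power2_minus mult_minus_left)
  qed
  ultimately have neg: "(image_term D11 L x t has_sum (\<Sum>n. - ?q n)) (range (\<lambda>n. - int n - 1))"
    by (subst has_sum_reindex) (auto simp: inj_on_def)
  have "(image_term D11 L x t has_sum ((\<Sum>n. ?p n) + (\<Sum>n. - ?q n))) (range int \<union> range (\<lambda>n. - int n - 1))"
    by (rule has_sum_Un_disjoint[OF pos neg]) auto
  moreover have "range int \<union> range (\<lambda>n. - int n - 1) = UNIV"
  proof -
    have "k \<in> range int \<union> range (\<lambda>n. - int n - 1)" for k
    proof (cases "k \<ge> 0")
      case True
      then show ?thesis
        using zero_le_imp_eq_int by fastforce
    next
      case False
      then have "k = - int (nat (- k - 1)) - 1"
        by simp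
      then show ?thesis
        by blast
    qed
    then show ?thesis
      by blast
  qed
  moreover have "(\<Sum>n. ?p n) + (\<Sum>n. - ?q n) = (\<Sum>n. image_pair L ?c x n)"
    unfolding image_pair_def using sums by (subst suminf_add) (simp_all add: sums_iff)
  ultimately show ?thesis
    by simp
qed

section \<open>Assembly of the two representations\<close>

text \<open>The clause about \<open>h\<close> justifies speaking of the inverse transform; equality
  almost everywhere is the most a Laplace integral can determine. The function \<open>g\<close> is
  built from the image series, and the pole formula is then an identity at each
  \<open>t > 0\<close>.\<close>

theorem mainTheorem2:
  fixes D11 v0 L x :: real
  assumes "D11 > 0" and "L > 0" and "0 < x" and "x \<le> L"
  shows "\<exists>g :: real \<Rightarrow> real.
     is_inverse_laplace g (G D11 v0 L x) \<and>
     (\<forall>h. is_inverse_laplace h (G D11 v0 L x) \<longrightarrow> (AE t in lborel. t > 0 \<longrightarrow> h t = g t)) \<and>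
     (\<forall>t>0.
        summable (\<lambda>k. pole_term D11 v0 L x t (Suc k)) \<and>
        g t = - exp (alpha D11 v0 * x) * (\<Sum>k. pole_term D11 v0 L x t (Suc k)) \<and>
        image_term D11 L x t summable_on UNIV \<and>
        g t = - (exp (alpha D11 v0 * x + D11 * s_zero D11 v0 * t) / (2 * sqrt (pi * D11 * t ^ 3)))
                * (\<Sum>\<^sub>\<infinity>n\<in>UNIV. image_term D11 L x t n))"
proof -
  have x: "x \<in> {0..L}"
    using assms by simp
  define S where "S t = (\<Sum>n. image_pair L (4 * D11 * t) x n)" for t
  define g where "g t = - (exp (alpha D11 v0 * x + D11 * s_zero D11 v0 * t)
      / (2 * sqrt (pi * D11 * t ^ 3))) * S t" for t
  have inv: "is_inverse_laplace g (G D11 v0 L x)"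
    unfolding is_inverse_laplace_def
  proof (intro allI impI)
    fix s :: real
    assume "s > 0"
    define b where "b = beta D11 v0 s"
    have "s_zero D11 v0 \<le> 0"
      by (simp add: s_zero_def)
    then have "s / D11 - s_zero D11 v0 > 0"
      using divide_pos_pos[OF \<open>s > 0\<close> \<open>D11 > 0\<close>] by linarith
    \<comment> \<open>This makes \<open>exp (- (D11 * b\<^sup>2 * t))\<close> split into the Laplace
      kernel \<open>exp (- s * t)\<close> and the factor
      \<open>exp (D11 * s_zero D11 v0 * t)\<close> belonging to \<open>g\<close>.\<close>
    then have b: "b > 0" "D11 * b\<^sup>2 = s - D11 * s_zero D11 v0"
      using assms by (simp_all add: b_def beta_def right_diff_distrib)
    have "has_bochner_integral lborel (\<lambda>t. - exp (alpha D11 v0 * x) *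
        (indicator {0<..} t * (exp (- (D11 * b\<^sup>2 * t)) / (2 * sqrt (pi * D11 * t ^ 3)) * S t)))
        (- exp (alpha D11 v0 * x) * (sinh ((L - x) * b) / sinh (L * b)))"
      unfolding S_def by (intro has_bochner_integral_mult_right image_series_laplace assms b)
    moreover have "- exp (alpha D11 v0 * x) *
        (indicator {0<..} t * (exp (- (D11 * b\<^sup>2 * t)) / (2 * sqrt (pi * D11 * t ^ 3)) * S t))
        = indicator {0<..} t *\<^sub>R (exp (- s * t) * g t)" for t
    proof -
      have "exp (- (D11 * b\<^sup>2 * t)) = exp (- s * t) * exp (D11 * s_zero D11 v0 * t)"
        unfolding b by (simp add: algebra_simps flip: exp_add)
      then show ?thesis
        by (simp add: g_def exp_add)
    qed
    ultimately show "set_integrable lborel {0<..} (\<lambda>t. exp (- s * t) * g t) \<and>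
        (LBINT t:{0<..}. exp (- s * t) * g t) = G D11 v0 L x s"
      unfolding set_integrable_def set_lebesgue_integral_def
      by (simp only: has_bochner_integral_iff G_def b_def)
  qed
  have "summable (\<lambda>k. pole_term D11 v0 L x t (Suc k)) \<and>
      g t = - exp (alpha D11 v0 * x) * (\<Sum>k. pole_term D11 v0 L x t (Suc k)) \<and>
      image_term D11 L x t summable_on UNIV \<and>
      g t = - (exp (alpha D11 v0 * x + D11 * s_zero D11 v0 * t) / (2 * sqrt (pi * D11 * t ^ 3)))
              * (\<Sum>\<^sub>\<infinity>n\<in>UNIV. image_term D11 L x t n)" if "t > 0" for t
  proof -
    let ?c = "4 * D11 * t"
    let ?C = "exp (D11 * s_zero D11 v0 * t) / (2 * sqrt (pi * D11 * t ^ 3))"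
    have "?c > 0"
      using assms that by simp
    note series = image_series_eq_sine_series[OF \<open>L > 0\<close> this x]
    \<comment> \<open>With \<open>r = sqrt (pi * D11 * t)\<close> and \<omega> =
      \<open>m * pi / L\<close>, the coefficient is
      \<open>2 / L * (D11 * t * \<omega>) * (2 * r)\<close>. Division by \<open>2 * r * t\<close>
      leaves \<open>2 * m * pi * D11 / L\<^sup>2\<close>, and the exponents add up to
      \<open>s_pole D11 v0 L m * t\<close>.\<close>
    have pole: "pole_term D11 v0 L x t (Suc k) = ?C * (2 / L * (?c * (real (Suc k) * pi / L) / 4
        * sqrt (pi * ?c) * exp (- ((real (Suc k) * pi / L)\<^sup>2 * ?c / 4)))
        * sin (real (Suc k) * pi * x / L))" for k
    proof -
      define r where "r = sqrt (pi * D11 * t)"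
      have r: "r > 0"
        using assms that by (simp add: r_def)
      have "sqrt (pi * D11 * t ^ 3) = sqrt (pi * D11 * t * t\<^sup>2)"
        by (simp add: power2_eq_square power3_eq_cube mult_ac)
      then have r3: "sqrt (pi * D11 * t ^ 3) = r * t"
        using that by (simp add: r_def real_sqrt_mult)
      have "sqrt (pi * ?c) = sqrt (2\<^sup>2 * (pi * D11 * t))"
        by (simp add: mult_ac)
      then have rc: "sqrt (pi * ?c) = 2 * r"
        by (simp only: real_sqrt_mult r_def) simp
      have "s_pole D11 v0 L (Suc k) * t = D11 * s_zero D11 v0 * t + - ((real (Suc k) * pi / L)\<^sup>2 * ?c / 4)"
        using assms
        by (simp add: s_pole_def s_zero_def power_mult_distrib power_divide field_simps power2_eq_square
            del: of_nat_Suc)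
      then have "exp (s_pole D11 v0 L (Suc k) * t)
          = exp (D11 * s_zero D11 v0 * t) * exp (- ((real (Suc k) * pi / L)\<^sup>2 * ?c / 4))"
        by (simp only: exp_add)
      then show ?thesis
        unfolding pole_term_def r3 rc using r that
        by (simp only:) (simp add: power2_eq_square del: of_nat_Suc)
    qed
    have summ: "summable (\<lambda>k. pole_term D11 v0 L x t (Suc k))"
      unfolding pole by (intro summable_mult series)
    have "(\<Sum>k. pole_term D11 v0 L x t (Suc k)) = ?C * S t"
      unfolding pole S_def series(2) by (intro suminf_mult series)
    then have "g t = - exp (alpha D11 v0 * x) * (\<Sum>k. pole_term D11 v0 L x t (Suc k))"
      by (simp add: g_def exp_add)
    moreover have "(image_term D11 L x t has_sum S t) UNIV"
      unfolding S_def by (intro has_sum_image_term assms x that)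
    ultimately show ?thesis
      using summ by (auto simp: g_def has_sum_imp_summable infsumI)
  qed
  with inv is_inverse_laplace_unique[OF inv] show ?thesis
    by blast
qed

end
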